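(* Let $M$ be a matroid on a finite ground set $E$ with collection of independent sets $\mathcal{I}$ and collection of bases $\mathcal{B}$, and let $\preceq$ be a total order on $E$. Let $D$ be the diagram obtained from the BDD $\mathsf{B}(\mathcal{B})$ with respect to $(E,\preceq)$ by setting $\nu_0\gets\nu_1$ for every non-terminal node $\nu$ with $\nu_0=\bot$ (i.e., replacing every 0-arc entering the 0-terminal by a copy of the corresponding 1-arc) and then exhaustively applying the BDD reduction rules (NS) and (B-ND). Then $D$ represents $\mathcal{I}$ (so $D=\mathsf{B}(\mathcal{I})$). Likewise, the diagram obtained from the ZDD $\mathsf{Z}(\mathcal{B})$ with respect to $(E,\preceq)$ by setting $\nu_0\gets\nu_1$ for every non-terminal node $\nu$ with $\nu_0=\bot$ represents $\mathcal{I}$, and it already satisfies the ZDD reduction rules (NS) and (Z-ND) immediately after this update (so it equals $\mathsf{Z}(\mathcal{I})$).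
   Context: A decision diagram over $(E,\preceq)$ is a directed acyclic graph with a unique root, at most two terminal nodes, the 0-terminal $\bot$ and the 1-terminal $\top$, and non-terminal nodes $\nu$, each with a label $\ell(\nu)\in E$ and exactly two outgoing arcs, the 0-arc $(\nu,\nu_0)$ and the 1-arc $(\nu,\nu_1)$, with $\ell(\nu)\prec\ell(\nu_0),\ell(\nu_1)$ (terminal labels regarded as larger than all elements of $E$). A 1-path is a directed path from the root to $\top$. Under BDD semantics a 1-path represents all $X\subseteq E$ containing the label of the tail of every 1-arc on the path and no label of the tail of any 0-arc on the path; under ZDD semantics it represents the single set of labels of tails of the 1-arcs on the path; the diagram represents the union. The BDD $\mathsf{B}(\mathcal{S})$ (resp. ZDD $\mathsf{Z}(\mathcal{S})$) of $\mathcal{S}\subseteq 2^E$ is the unique diagram obtained from the complete binary decision tree of $\mathcal{S}$ (internal nodes at depth $j$ labeled by the $(j+1)$-th smallest element of $E$; the leaf reached by taking 1-arcs exactly at the elements of $X$ is $\top$ iff $X\in\mathcal{S}$, else $\bot$) by exhaustively applying: (NS) merge non-terminal nodes with the same label, same 0-successor and same 1-successor; and for BDDs (B-ND) remove every non-terminal $\nu$ with $\nu_0=\nu_1$, redirecting arcs entering $\nu$ to $\nu_0$; for ZDDs (Z-ND) remove every non-terminal $\nu$ with $\nu_1=\bot$, redirecting arcs entering $\nu$ to $\nu_0$. $\mathsf{B}(\mathcal{S})$ (BDD semantics) and $\mathsf{Z}(\mathcal{S})$ (ZDD semantics) represent $\mathcal{S}$. *)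

theory Defs
  imports Main
begin

section \<open>Matroids\<close>

locale matroid =
  fixes E :: "'a set" and indep :: "'a set set"
  assumes finite_ground: "finite E"
    and indep_subset: "X \<in> indep \<Longrightarrow> X \<subseteq> E"
    and indep_empty: "{} \<in> indep"
    and indep_mono: "X \<in> indep \<Longrightarrow> Y \<subseteq> X \<Longrightarrow> Y \<in> indep"
    and indep_augment:
      "X \<in> indep \<Longrightarrow> Y \<in> indep \<Longrightarrow> card X < card Y \<Longrightarrow> \<exists>y\<in>Y - X. insert y X \<in> indep"

definition bases :: "'a set set \<Rightarrow> 'a set set" where
  "bases indep = {B \<in> indep. \<forall>X\<in>indep. B \<subseteq> X \<longrightarrow> X = B}"


section \<open>Decision diagrams\<close>

datatype 'n vertex = Bot | Top | Node 'n

text \<open>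
  Only the non-terminal nodes are stored explicitly. A terminal belongs to the diagram iff it is the
  root or the head of some arc (see \<open>verts\<close>), so that a terminal which loses its last entering
  arc disappears. The values of \<open>label\<close>, \<open>succ0\<close> and \<open>succ1\<close> outside \<open>nodes\<close> are irrelevant.
\<close>

record ('n, 'a) diagram =
  nodes :: "'n set"
  root :: "'n vertex"
  label :: "'n \<Rightarrow> 'a"
  succ0 :: "'n \<Rightarrow> 'n vertex"
  succ1 :: "'n \<Rightarrow> 'n vertex"

definition target :: "('n, 'a) diagram \<Rightarrow> bool \<Rightarrow> 'n \<Rightarrow> 'n vertex" where
  "target D b n = (if b then succ1 D n else succ0 D n)"

definition arcs :: "('n, 'a) diagram \<Rightarrow> ('n vertex \<times> 'n vertex) set" where
  "arcs D = {(Node n, target D b n) | n b. n \<in> nodes D}"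

definition verts :: "('n, 'a) diagram \<Rightarrow> 'n vertex set" where
  "verts D = insert (root D) (Node ` nodes D \<union> snd ` arcs D)"

definition strictly_before :: "'a rel \<Rightarrow> 'a \<Rightarrow> 'a \<Rightarrow> bool" where
  "strictly_before r x y \<longleftrightarrow> (x, y) \<in> r \<and> x \<noteq> y"

definition decision_diagram :: "'a set \<Rightarrow> 'a rel \<Rightarrow> ('n, 'a) diagram \<Rightarrow> bool" where
  "decision_diagram E r D \<longleftrightarrow>
     finite (nodes D) \<and>
     verts D \<subseteq> {Bot, Top} \<union> Node ` nodes D \<and>
     acyclic (arcs D) \<and>
     {v \<in> verts D. \<nexists>u. (u, v) \<in> arcs D} = {root D} \<and>
     (\<forall>n\<in>nodes D. label D n \<in> E) \<and>
     (\<forall>n\<in>nodes D. \<forall>b m. target D b n = Node m \<longrightarrow>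
        strictly_before r (label D n) (label D m))"

text \<open>
  A path is the list of its arcs. The pair \<open>(n, b)\<close> is the 1-arc of \<open>n\<close> if \<open>b\<close>, its 0-arc
  otherwise; these are different arcs even if they have the same head.
\<close>

inductive path :: "('n, 'a) diagram \<Rightarrow> 'n vertex \<Rightarrow> ('n \<times> bool) list \<Rightarrow> 'n vertex \<Rightarrow> bool"
  for D where
  path_Nil: "path D v [] v"
| path_Cons: "n \<in> nodes D \<Longrightarrow> path D (target D b n) p w \<Longrightarrow> path D (Node n) ((n, b) # p) w"

definition one_path :: "('n, 'a) diagram \<Rightarrow> ('n \<times> bool) list \<Rightarrow> bool" where
  "one_path D p \<longleftrightarrow> path D (root D) p Top"

definition bdd_family :: "'a set \<Rightarrow> ('n, 'a) diagram \<Rightarrow> 'a set set" where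
  "bdd_family E D =
     {X. X \<subseteq> E \<and> (\<exists>p. one_path D p \<and>
        (\<forall>n. (n, True) \<in> set p \<longrightarrow> label D n \<in> X) \<and>
        (\<forall>n. (n, False) \<in> set p \<longrightarrow> label D n \<notin> X))}"

definition zdd_family :: "('n, 'a) diagram \<Rightarrow> 'a set set" where
  "zdd_family D = {{label D n | n. (n, True) \<in> set p} | p. one_path D p}"

definition bdd_represents :: "'a set \<Rightarrow> 'a rel \<Rightarrow> ('n, 'a) diagram \<Rightarrow> 'a set set \<Rightarrow> bool" where
  "bdd_represents E r D S \<longleftrightarrow> decision_diagram E r D \<and> bdd_family E D = S"

definition zdd_represents :: "'a set \<Rightarrow> 'a rel \<Rightarrow> ('n, 'a) diagram \<Rightarrow> 'a set set \<Rightarrow> bool" where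
  "zdd_represents E r D S \<longleftrightarrow> decision_diagram E r D \<and> zdd_family D = S"

text \<open>
  For a decision diagram, \<open>{n. Node n \<in> verts D}\<close> is just \<open>nodes D\<close>. The type also has records whose
  root or arcs point to a \<open>Node\<close> outside \<open>nodes\<close>; asking for a bijection between the former sets
  prevents these from being isomorphic to a decision diagram.
\<close>

definition isomorphic :: "('n, 'a) diagram \<Rightarrow> ('m, 'a) diagram \<Rightarrow> bool" where
  "isomorphic D D' \<longleftrightarrow>
     (\<exists>f. bij_betw f {n. Node n \<in> verts D} {n. Node n \<in> verts D'} \<and>
        f ` nodes D = nodes D' \<and>
        root D' = map_vertex f (root D) \<and>
        (\<forall>n\<in>nodes D. label D' (f n) = label D n \<and>
           succ0 D' (f n) = map_vertex f (succ0 D n) \<and>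
           succ1 D' (f n) = map_vertex f (succ1 D n)))"


section \<open>Reduction\<close>

definition redirect :: "'n \<Rightarrow> 'n vertex \<Rightarrow> 'n vertex \<Rightarrow> 'n vertex" where
  "redirect n v u = (if u = Node n then v else u)"

definition remove_node :: "('n, 'a) diagram \<Rightarrow> 'n \<Rightarrow> 'n vertex \<Rightarrow> ('n, 'a) diagram" where
  "remove_node D n v =
     \<lparr>nodes = nodes D - {n},
      root = redirect n v (root D),
      label = label D,
      succ0 = redirect n v \<circ> succ0 D,
      succ1 = redirect n v \<circ> succ1 D\<rparr>"

definition ns_step :: "('n, 'a) diagram \<Rightarrow> ('n, 'a) diagram \<Rightarrow> bool" where
  "ns_step D D' \<longleftrightarrow>
     (\<exists>m\<in>nodes D. \<exists>n\<in>nodes D. m \<noteq> n \<and> label D m = label D n \<and>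
        succ0 D m = succ0 D n \<and> succ1 D m = succ1 D n \<and>
        D' = remove_node D n (Node m))"

definition b_nd_step :: "('n, 'a) diagram \<Rightarrow> ('n, 'a) diagram \<Rightarrow> bool" where
  "b_nd_step D D' \<longleftrightarrow>
     (\<exists>n\<in>nodes D. succ0 D n = succ1 D n \<and> D' = remove_node D n (succ0 D n))"

definition z_nd_step :: "('n, 'a) diagram \<Rightarrow> ('n, 'a) diagram \<Rightarrow> bool" where
  "z_nd_step D D' \<longleftrightarrow>
     (\<exists>n\<in>nodes D. succ1 D n = Bot \<and> D' = remove_node D n (succ0 D n))"

definition bdd_step :: "('n, 'a) diagram \<Rightarrow> ('n, 'a) diagram \<Rightarrow> bool" where
  "bdd_step D D' \<longleftrightarrow> ns_step D D' \<or> b_nd_step D D'"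

definition zdd_step :: "('n, 'a) diagram \<Rightarrow> ('n, 'a) diagram \<Rightarrow> bool" where
  "zdd_step D D' \<longleftrightarrow> ns_step D D' \<or> z_nd_step D D'"

definition irreducible_for :: "('d \<Rightarrow> 'd \<Rightarrow> bool) \<Rightarrow> 'd \<Rightarrow> bool" where
  "irreducible_for step D \<longleftrightarrow> (\<nexists>D'. step D D')"

definition exhaustively :: "('d \<Rightarrow> 'd \<Rightarrow> bool) \<Rightarrow> 'd \<Rightarrow> 'd \<Rightarrow> bool" where
  "exhaustively step D D' \<longleftrightarrow> step\<^sup>*\<^sup>* D D' \<and> irreducible_for step D'"


section \<open>The BDD and the ZDD of a set family\<close>

text \<open>The \<open>(j + 1)\<close>-th smallest element of \<open>E\<close>.\<close>

definition nth_smallest :: "'a set \<Rightarrow> 'a rel \<Rightarrow> nat \<Rightarrow> 'a" where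
  "nth_smallest E r j = (THE e. e \<in> E \<and> card {x \<in> E. strictly_before r x e} = j)"

text \<open>
  A position in the complete binary decision tree is the list of choices leading to it from the
  root, \<open>True\<close> for a 1-arc; all leaves with the same value are one terminal.
\<close>

definition tree_vertex :: "'a set \<Rightarrow> 'a rel \<Rightarrow> 'a set set \<Rightarrow> bool list \<Rightarrow> bool list vertex" where
  "tree_vertex E r S p =
     (if length p < card E then Node p
      else if {nth_smallest E r j | j. j < length p \<and> p ! j} \<in> S then Top else Bot)"

definition decision_tree :: "'a set \<Rightarrow> 'a rel \<Rightarrow> 'a set set \<Rightarrow> (bool list, 'a) diagram" where
  "decision_tree E r S =
     \<lparr>nodes = {p. length p < card E},
      root = tree_vertex E r S [],
      label = (\<lambda>p. nth_smallest E r (length p)),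
      succ0 = (\<lambda>p. tree_vertex E r S (p @ [False])),
      succ1 = (\<lambda>p. tree_vertex E r S (p @ [True]))\<rparr>"

text \<open>
  Diagrams are identified up to isomorphism: \<open>is_BDD E r S D\<close> says that \<open>D\<close> is (a copy of) the BDD
  of \<open>S\<close>, whichever order of rule applications was chosen; likewise \<open>is_ZDD\<close>.
\<close>

definition is_BDD :: "'a set \<Rightarrow> 'a rel \<Rightarrow> 'a set set \<Rightarrow> ('n, 'a) diagram \<Rightarrow> bool" where
  "is_BDD E r S D \<longleftrightarrow>
     (\<exists>D'. exhaustively bdd_step (decision_tree E r S) D' \<and> isomorphic D D')"

definition is_ZDD :: "'a set \<Rightarrow> 'a rel \<Rightarrow> 'a set set \<Rightarrow> ('n, 'a) diagram \<Rightarrow> bool" where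
  "is_ZDD E r S D \<longleftrightarrow>
     (\<exists>D'. exhaustively zdd_step (decision_tree E r S) D' \<and> isomorphic D D')"

definition redirect_zero_arcs :: "('n, 'a) diagram \<Rightarrow> ('n, 'a) diagram" where
  "redirect_zero_arcs D =
     \<lparr>nodes = nodes D,
      root = root D,
      label = label D,
      succ0 = (\<lambda>n. if succ0 D n = Bot then succ1 D n else succ0 D n),
      succ1 = succ1 D\<rparr>"


section \<open>Existence of exhaustive reductions\<close>

lemma nodes_remove_node [simp]: "nodes (remove_node D n v) = nodes D - {n}"
  by (simp add: remove_node_def)

lemma exhaustively_exists:
  assumes dec: "\<And>D D'. step D D' \<Longrightarrow> \<exists>n\<in>nodes D. nodes D' = nodes D - {n}"
    and "finite (nodes D)"
  shows "\<exists>D'. exhaustively step D D'"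
  using \<open>finite (nodes D)\<close>
proof (induction "card (nodes D)" arbitrary: D rule: less_induct)
  case less
  show ?case
  proof (cases "irreducible_for step D")
    case True
    then show ?thesis unfolding exhaustively_def by blast
  next
    case False
    then obtain D1 where D1: "step D D1" unfolding irreducible_for_def by blast
    from dec[OF D1] obtain n where n: "n \<in> nodes D" "nodes D1 = nodes D - {n}" by blast
    have "card (nodes D1) < card (nodes D)" "finite (nodes D1)"
      using n less.prems card_Diff1_less[of "nodes D" n] by auto
    from less.hyps[OF this] obtain D' where "exhaustively step D1 D'" by blast
    with D1 show ?thesis
      unfolding exhaustively_def by (meson converse_rtranclp_into_rtranclp)
  qed
qed

lemma bdd_exhaustively_exists: "finite (nodes D) \<Longrightarrow> \<exists>D'. exhaustively bdd_step D D'"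
  by (rule exhaustively_exists) (auto simp: bdd_step_def ns_step_def b_nd_step_def)

lemma zdd_exhaustively_exists: "finite (nodes D) \<Longrightarrow> \<exists>D'. exhaustively zdd_step D D'"
  by (rule exhaustively_exists) (auto simp: zdd_step_def ns_step_def z_nd_step_def)

lemma finite_nodes_decision_tree: "finite (nodes (decision_tree E r S))"
proof -
  have "finite {p :: bool list. set p \<subseteq> UNIV \<and> length p \<le> card E}"
    by (rule finite_lists_length_le) simp
  then have "finite {p :: bool list. length p < card E}"
    by (rule rev_finite_subset) auto
  then show ?thesis by (simp add: decision_tree_def)
qed

lemma isomorphic_refl: "isomorphic D D"
  unfolding isomorphic_def
  by (rule exI[of _ id]) (simp add: vertex.map_id0)

lemma is_BDD_exists: "\<exists>D :: (bool list, 'a) diagram. is_BDD E r S D"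
  unfolding is_BDD_def
  using bdd_exhaustively_exists[OF finite_nodes_decision_tree] isomorphic_refl by blast

lemma is_ZDD_exists: "\<exists>D :: (bool list, 'a) diagram. is_ZDD E r S D"
  unfolding is_ZDD_def
  using zdd_exhaustively_exists[OF finite_nodes_decision_tree] isomorphic_refl by blast

end

theory Submission
  imports Defs
begin

text \<open>
  A diagram is determined up to isomorphism by the tree obtained by unfolding it from its root, as
  soon as all its nodes are reachable and different nodes unfold to different trees. (NS) does not
  change this tree and the deletion rules do not change its normal form, so an exhaustive reduction
  is determined by the normal form of the unfolding, and the theorem becomes a statement about
  trees. It is proved by induction along the order. For a family \<open>F\<close> with the basis exchange
  property and its smallest element \<open>e\<close>, let \<open>F0\<close> and \<open>F1\<close> be the families below the 0-arc and the
  1-arc. The members of the down-closure of \<open>F\<close> avoiding \<open>e\<close> lie in the down-closure of \<open>F0\<close> or of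
  \<open>F1\<close>, and exchanging \<open>e\<close> shows that the first contains the second unless \<open>F0\<close> is empty, which is
  the case in which the 0-arc is redirected. Exchange also excludes that \<open>F0 = F1\<close> is nonempty, so
  the redirection does not create equal nodes in the ZDD.
\<close>

section \<open>Decision trees\<close>

datatype 'a dtree = Leaf0 | Leaf1 | Branch 'a "'a dtree" "'a dtree"

text \<open>Normal form of a tree under (B-ND), computed from the leaves upward; (NS) leaves no
  trace here because a tree does not record sharing.\<close>

fun b_reduce :: "'a dtree \<Rightarrow> 'a dtree" where
  "b_reduce (Branch e s t) =
     (if b_reduce s = b_reduce t then b_reduce s else Branch e (b_reduce s) (b_reduce t))"
| "b_reduce t = t"

fun z_reduce :: "'a dtree \<Rightarrow> 'a dtree" where
  "z_reduce (Branch e s t) =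
     (if z_reduce t = Leaf0 then z_reduce s else Branch e (z_reduce s) (z_reduce t))"
| "z_reduce t = t"

text \<open>The test is made on the subtree before its own redirection, as the update of a diagram
  inspects the original 0-arcs. The copied 1-branch is redirected as well, being the unfolding of a
  shared successor.\<close>

fun redirect_tree :: "'a dtree \<Rightarrow> 'a dtree" where
  "redirect_tree (Branch e s t) =
     Branch e (redirect_tree (if s = Leaf0 then t else s)) (redirect_tree t)"
| "redirect_tree t = t"

fun b_eval :: "'a dtree \<Rightarrow> 'a set \<Rightarrow> bool" where
  "b_eval Leaf0 X = False"
| "b_eval Leaf1 X = True"
| "b_eval (Branch e s t) X = b_eval (if e \<in> X then t else s) X"

fun z_sets :: "'a dtree \<Rightarrow> 'a set set" where
  "z_sets Leaf0 = {}"
| "z_sets Leaf1 = {{}}"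
| "z_sets (Branch e s t) = z_sets s \<union> insert e ` z_sets t"

fun hereditarily :: "('a dtree \<Rightarrow> 'a dtree \<Rightarrow> bool) \<Rightarrow> 'a dtree \<Rightarrow> bool" where
  "hereditarily P (Branch e s t) \<longleftrightarrow> P s t \<and> hereditarily P s \<and> hereditarily P t"
| "hereditarily P t \<longleftrightarrow> True"

fun ordered_tree :: "'a rel \<Rightarrow> 'a dtree \<Rightarrow> bool" where
  "ordered_tree r (Branch e s t) \<longleftrightarrow>
     (\<forall>x \<in> set_dtree s \<union> set_dtree t. strictly_before r e x) \<and> ordered_tree r s \<and> ordered_tree r t"
| "ordered_tree r t \<longleftrightarrow> True"

section \<open>Semantics, labels and order of reduced trees\<close>

lemma b_eval_b_reduce: "b_eval (b_reduce t) X = b_eval t X"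
proof (induction t)
  case (Branch e s t)
  have "b_eval (b_reduce (Branch e s t)) X = b_eval (if e \<in> X then b_reduce t else b_reduce s) X"
    by (cases "b_reduce s = b_reduce t") auto
  then show ?case using Branch by simp
qed auto

lemma z_sets_z_reduce: "z_sets (z_reduce t) = z_sets t"
proof (induction t)
  case (Branch e s t)
  show ?case
  proof (cases "z_reduce t = Leaf0")
    case True
    then have "z_sets t = {}" using Branch by simp
    then show ?thesis using Branch True by simp
  qed (use Branch in simp)
qed auto

lemma set_b_reduce: "set_dtree (b_reduce t) \<subseteq> set_dtree t"
  by (induction t) auto

lemma set_z_reduce: "set_dtree (z_reduce t) \<subseteq> set_dtree t"
  by (induction t) auto

lemma ordered_b_reduce: "ordered_tree r t \<Longrightarrow> ordered_tree r (b_reduce t)"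
  by (induction t) (use set_b_reduce in fastforce)+

lemma ordered_z_reduce: "ordered_tree r t \<Longrightarrow> ordered_tree r (z_reduce t)"
  by (induction t) (use set_z_reduce in fastforce)+

lemma z_reduce_normal: "hereditarily (\<lambda>s t. t \<noteq> Leaf0) (z_reduce t)"
  by (induction t) auto


section \<open>Trees of set families\<close>

definition without :: "'a \<Rightarrow> 'a set set \<Rightarrow> 'a set set" where
  "without e F = {X \<in> F. e \<notin> X}"

definition link :: "'a \<Rightarrow> 'a set set \<Rightarrow> 'a set set" where
  "link e F = {X. e \<notin> X \<and> insert e X \<in> F}"

definition down :: "'a set set \<Rightarrow> 'a set set" where
  "down F = {Y. \<exists>X \<in> F. Y \<subseteq> X}"

text \<open>Basis exchange without demanding a nonempty family, so that it can pass to
  \<open>without e F\<close> and \<open>link e F\<close>, either of which may be empty.\<close>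

definition exchange :: "'a set set \<Rightarrow> bool" where
  "exchange F \<longleftrightarrow> (\<forall>X \<in> F. \<forall>Y \<in> F. \<forall>x \<in> X - Y. \<exists>y \<in> Y - X. insert y (X - {x}) \<in> F)"

text \<open>For distinct \<open>L\<close>, the family that remains at a leaf contains the empty set
  iff the elements chosen on the way form a member of the initial family.\<close>

fun full_tree :: "'a list \<Rightarrow> 'a set set \<Rightarrow> 'a dtree" where
  "full_tree [] F = (if {} \<in> F then Leaf1 else Leaf0)"
| "full_tree (e # L) F = Branch e (full_tree L (without e F)) (full_tree L (link e F))"

lemma without_Pow: "F \<subseteq> Pow (set (e # L)) \<Longrightarrow> without e F \<subseteq> Pow (set L)"
  by (auto simp: without_def)

lemma link_Pow: "F \<subseteq> Pow (set (e # L)) \<Longrightarrow> link e F \<subseteq> Pow (set L)"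
  by (auto simp: link_def)

lemma down_Pow: "F \<subseteq> Pow A \<Longrightarrow> down F \<subseteq> Pow A"
  by (auto simp: down_def)

lemma without_union_link: "without e F \<union> insert e ` link e F = F"
proof -
  have "X \<in> insert e ` link e F" if "X \<in> F" "e \<in> X" for X
    using that by (intro image_eqI[of _ _ "X - {e}"]) (auto simp: link_def insert_absorb)
  then show ?thesis by (auto simp: without_def link_def)
qed

lemma empty_iff_without_link: "F = {} \<longleftrightarrow> without e F = {} \<and> link e F = {}"
  using without_union_link[of e F] by auto

lemma down_eq_empty [simp]: "down F = {} \<longleftrightarrow> F = {}"
  by (auto simp: down_def)

lemma down_empty [simp]: "down {} = {}"
  by simp

lemma link_down: "link e (down F) = down (link e F)"
proof (intro set_eqI iffI)
  fix Y assume "Y \<in> link e (down F)"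
  then obtain X where "e \<notin> Y" "X \<in> F" "insert e Y \<subseteq> X" by (auto simp: link_def down_def)
  then have "X - {e} \<in> link e F" "Y \<subseteq> X - {e}" by (auto simp: link_def insert_absorb)
  then show "Y \<in> down (link e F)" by (auto simp: down_def)
qed (auto simp: link_def down_def)

lemma without_down: "without e (down F) = down (without e F) \<union> down (link e F)"
proof (intro set_eqI iffI)
  fix Y assume "Y \<in> without e (down F)"
  then obtain X where X: "e \<notin> Y" "X \<in> F" "Y \<subseteq> X" by (auto simp: without_def down_def)
  show "Y \<in> down (without e F) \<union> down (link e F)"
  proof (cases "e \<in> X")
    case True
    then have "X - {e} \<in> link e F" "Y \<subseteq> X - {e}" using X by (auto simp: link_def insert_absorb)
    then show ?thesis by (auto simp: down_def)
  qed (use X in \<open>auto simp: without_def down_def\<close>)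
next
  fix Y assume "Y \<in> down (without e F) \<union> down (link e F)"
  then show "Y \<in> without e (down F)"
  proof
    assume "Y \<in> down (link e F)"
    then obtain X where "e \<notin> X" "insert e X \<in> F" "Y \<subseteq> X" by (auto simp: link_def down_def)
    then show ?thesis by (auto simp: without_def down_def intro: bexI[of _ "insert e X"])
  qed (auto simp: without_def down_def)
qed

text \<open>The element brought in by an exchange comes from a set avoiding \<open>e\<close>, so the
  result avoids \<open>e\<close> too.\<close>

lemma exchange_without: "exchange F \<Longrightarrow> exchange (without e F)"
  unfolding exchange_def without_def by fastforce

text \<open>Exchange in \<open>F\<close> between \<open>insert e X\<close> and
  \<open>insert e Y\<close>: the element removed is not \<open>e\<close>, and the one brought in is
  not \<open>e\<close> because \<open>e\<close> already lies in \<open>insert e X\<close>.\<close>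

lemma exchange_link:
  assumes "exchange F"
  shows "exchange (link e F)"
  unfolding exchange_def
proof (intro ballI)
  fix X Y x assume X: "X \<in> link e F" and Y: "Y \<in> link e F" and x: "x \<in> X - Y"
  then have "x \<noteq> e" "e \<notin> X" "e \<notin> Y" by (auto simp: link_def)
  with assms X Y x obtain y where y: "y \<in> Y - X" "insert y (insert e X - {x}) \<in> F"
    unfolding exchange_def link_def by (metis (no_types, lifting) Diff_iff insert_iff mem_Collect_eq)
  moreover have "insert y (insert e X - {x}) = insert e (insert y (X - {x}))"
    using \<open>x \<noteq> e\<close> by auto
  ultimately show "\<exists>y \<in> Y - X. insert y (X - {x}) \<in> link e F"
    using \<open>e \<notin> X\<close> \<open>e \<notin> Y\<close> by (auto simp: link_def)
qed

text \<open>Exchanging \<open>e\<close> out of \<open>insert e X\<close> against a member that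
  avoids \<open>e\<close> yields a member of \<open>without e F\<close> containing
  \<open>X\<close>.\<close>

lemma exchange_down_link_le:
  assumes "exchange F" and "without e F \<noteq> {}"
  shows "down (link e F) \<subseteq> down (without e F)"
proof -
  from assms(2) obtain Y where Y: "Y \<in> F" "e \<notin> Y" by (auto simp: without_def)
  have "\<exists>Z \<in> without e F. X \<subseteq> Z" if "X \<in> link e F" for X
  proof -
    from that have X: "e \<notin> X" "insert e X \<in> F" by (auto simp: link_def)
    with assms(1) Y obtain y where "y \<in> Y - insert e X" "insert y (insert e X - {e}) \<in> F"
      unfolding exchange_def by blast
    then show ?thesis
      using X Y by (intro bexI[of _ "insert y (insert e X - {e})"]) (auto simp: without_def)
  qed
  then have "\<exists>Z \<in> without e F. Y \<subseteq> Z" if "X \<in> link e F" "Y \<subseteq> X" for X Y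
    using that by (meson order_trans)
  then show ?thesis by (auto simp: down_def)
qed

text \<open>Counterpart of the redirection on families: \<open>without e F = {}\<close> is the case
  of a 0-arc entering the 0-terminal, and there the two children of the down-closure
  coincide.\<close>

lemma exchange_without_down:
  assumes "exchange F"
  shows "without e (down F) = (if without e F = {} then down (link e F) else down (without e F))"
proof (cases "without e F = {}")
  case True
  then show ?thesis using without_down[of e F] by simp
next
  case False
  then show ?thesis using without_down[of e F] exchange_down_link_le[OF assms, of e] by auto
qed

text \<open>Exchange makes \<open>F\<close> an antichain: if \<open>X\<close> and
  \<open>insert e X\<close> were both members, removing \<open>e\<close> from the larger would
  require a replacement from \<open>X - insert e X\<close>, which is empty.\<close>

lemma exchange_without_neq_link:
  assumes "exchange F" and "F \<noteq> {}"
  shows "without e F \<noteq> link e F"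
proof
  assume eq: "without e F = link e F"
  then obtain X where "X \<in> without e F" "X \<in> link e F"
    using assms(2) empty_iff_without_link[of F e] by auto
  then have "X \<in> F" "insert e X \<in> F" "e \<in> insert e X - X" by (auto simp: without_def link_def)
  then show False
    using assms(1)[unfolded exchange_def, rule_format, of "insert e X" X e] by auto
qed

section \<open>Canonicity of reduced trees\<close>

lemma b_eval_full_tree: "distinct L \<Longrightarrow> b_eval (full_tree L F) X \<longleftrightarrow> X \<inter> set L \<in> F"
proof (induction L arbitrary: F)
  case (Cons e L)
  then show ?case by (cases "e \<in> X") (auto simp: without_def link_def)
qed auto

lemma z_sets_full_tree: "distinct L \<Longrightarrow> F \<subseteq> Pow (set L) \<Longrightarrow> z_sets (full_tree L F) = F"
proof (induction L arbitrary: F)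
  case (Cons e L)
  then show ?case
    using Cons.IH[OF _ without_Pow] Cons.IH[OF _ link_Pow] without_union_link[of e F] by simp
qed auto

text \<open>Reduction preserves \<open>b_eval\<close>, and the values on subsets of
  \<open>set L\<close> determine the family.\<close>

lemma b_reduce_full_tree_inj:
  assumes "distinct L" "F \<subseteq> Pow (set L)" "G \<subseteq> Pow (set L)"
    and "b_reduce (full_tree L F) = b_reduce (full_tree L G)"
  shows "F = G"
proof -
  have "X \<inter> set L \<in> F \<longleftrightarrow> X \<inter> set L \<in> G" for X
    using assms(4) b_eval_b_reduce[of "full_tree L F" X] b_eval_b_reduce[of "full_tree L G" X]
    by (simp add: b_eval_full_tree[OF assms(1)])
  then have "X \<in> F \<longleftrightarrow> X \<in> G" if "X \<subseteq> set L" for X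
    using that by (metis Int_absorb2)
  then show ?thesis using assms(2,3) by blast
qed

lemma z_reduce_full_tree_inj:
  assumes "distinct L" "F \<subseteq> Pow (set L)" "G \<subseteq> Pow (set L)"
    and "z_reduce (full_tree L F) = z_reduce (full_tree L G)"
  shows "F = G"
proof -
  have "z_sets (full_tree L F) = z_sets (full_tree L G)"
    using assms(4) by (metis z_sets_z_reduce)
  then show ?thesis
    unfolding z_sets_full_tree[OF assms(1,2)] z_sets_full_tree[OF assms(1,3)] .
qed

lemma b_reduce_full_tree_empty [simp]: "b_reduce (full_tree L {}) = Leaf0"
  by (induction L) (auto simp: without_def link_def)

lemma z_reduce_full_tree_empty [simp]: "z_reduce (full_tree L {}) = Leaf0"
  by (induction L) (auto simp: without_def link_def)

lemma b_reduce_full_tree_Leaf0_iff: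
  "distinct L \<Longrightarrow> F \<subseteq> Pow (set L) \<Longrightarrow> b_reduce (full_tree L F) = Leaf0 \<longleftrightarrow> F = {}"
  using b_reduce_full_tree_inj[of L F "{}"] by (metis empty_subsetI b_reduce_full_tree_empty)

lemma z_reduce_full_tree_Leaf0_iff:
  "distinct L \<Longrightarrow> F \<subseteq> Pow (set L) \<Longrightarrow> z_reduce (full_tree L F) = Leaf0 \<longleftrightarrow> F = {}"
  using z_reduce_full_tree_inj[of L F "{}"] by (metis empty_subsetI z_reduce_full_tree_empty)

text \<open>The outer \<open>b_reduce\<close> deletes the branches that redirection has given two
  equal children.\<close>

lemma b_reduce_redirect_tree:
  "distinct L \<Longrightarrow> F \<subseteq> Pow (set L) \<Longrightarrow> exchange F \<Longrightarrow>
     b_reduce (redirect_tree (b_reduce (full_tree L F))) = b_reduce (full_tree L (down F))"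
proof (induction L arbitrary: F)
  case Nil
  then show ?case by (auto simp: down_def)
next
  case (Cons e L)
  let ?F0 = "without e F" and ?F1 = "link e F"
  have L: "distinct L" and F0: "?F0 \<subseteq> Pow (set L)" and F1: "?F1 \<subseteq> Pow (set L)"
    using Cons.prems(1) without_Pow[OF Cons.prems(2)] link_Pow[OF Cons.prems(2)] by simp_all
  note IH0 = Cons.IH[OF L F0 exchange_without[OF Cons.prems(3)]]
  note IH1 = Cons.IH[OF L F1 exchange_link[OF Cons.prems(3)]]
  show ?case
  proof (cases "F = {}")
    case True
    then show ?thesis by (auto simp: down_def without_def link_def)
  next
    case False
    then have "?F0 \<noteq> ?F1" by (rule exchange_without_neq_link[OF Cons.prems(3)])
    \<comment> \<open>Hence (B-ND) keeps the branch at \<open>e\<close>, so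
      \<open>redirect_tree\<close> meets it, and its two cases match those of
      \<open>exchange_without_down\<close>.\<close>
    then have "b_reduce (full_tree L ?F0) \<noteq> b_reduce (full_tree L ?F1)"
      using b_reduce_full_tree_inj[OF L F0 F1] by blast
    then show ?thesis
      using IH0 IH1 b_reduce_full_tree_Leaf0_iff[OF L F0]
      by (simp add: link_down exchange_without_down[OF Cons.prems(3)])
  qed
qed

text \<open>Redirection turns no other 1-child into \<open>Leaf0\<close>, so a tree that is normal
  for (Z-ND) stays normal. If \<open>link e F\<close> is empty, the branch at \<open>e\<close> is
  absent on both sides.\<close>

lemma redirect_tree_z_reduce:
  "distinct L \<Longrightarrow> F \<subseteq> Pow (set L) \<Longrightarrow> exchange F \<Longrightarrow>
     redirect_tree (z_reduce (full_tree L F)) = z_reduce (full_tree L (down F))"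
proof (induction L arbitrary: F)
  case Nil
  then show ?case by (auto simp: down_def)
next
  case (Cons e L)
  let ?F0 = "without e F" and ?F1 = "link e F"
  have L: "distinct L" and F0: "?F0 \<subseteq> Pow (set L)" and F1: "?F1 \<subseteq> Pow (set L)"
    using Cons.prems(1) without_Pow[OF Cons.prems(2)] link_Pow[OF Cons.prems(2)] by simp_all
  note IH0 = Cons.IH[OF L F0 exchange_without[OF Cons.prems(3)]]
  note IH1 = Cons.IH[OF L F1 exchange_link[OF Cons.prems(3)]]
  show ?case
    using IH0 IH1 z_reduce_full_tree_Leaf0_iff[OF L F0] z_reduce_full_tree_Leaf0_iff[OF L F1]
      z_reduce_full_tree_Leaf0_iff[OF L down_Pow[OF F1]]
    by (cases "?F1 = {}"; cases "?F0 = {}")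
      (simp_all add: link_down exchange_without_down[OF Cons.prems(3)])
qed

text \<open>A branch survives \<open>z_reduce\<close> only if its 1-child belongs to a nonempty
  family; exchange then makes the two subfamilies, hence the two reduced subtrees, different. This
  keeps redirection from creating nodes to merge.\<close>

lemma z_reduce_full_tree_exchange:
  "distinct L \<Longrightarrow> F \<subseteq> Pow (set L) \<Longrightarrow> exchange F \<Longrightarrow>
     hereditarily (\<noteq>) (z_reduce (full_tree L F))"
proof (induction L arbitrary: F)
  case (Cons e L)
  let ?F0 = "without e F" and ?F1 = "link e F"
  have L: "distinct L" and F0: "?F0 \<subseteq> Pow (set L)" and F1: "?F1 \<subseteq> Pow (set L)"
    using Cons.prems(1) without_Pow[OF Cons.prems(2)] link_Pow[OF Cons.prems(2)] by simp_all
  note IH0 = Cons.IH[OF L F0 exchange_without[OF Cons.prems(3)]]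
  note IH1 = Cons.IH[OF L F1 exchange_link[OF Cons.prems(3)]]
  have "z_reduce (full_tree L ?F0) \<noteq> z_reduce (full_tree L ?F1)"
    if "z_reduce (full_tree L ?F1) \<noteq> Leaf0"
  proof -
    have "F \<noteq> {}" using that by (auto simp: link_def)
    then show ?thesis
      using exchange_without_neq_link[OF Cons.prems(3)] z_reduce_full_tree_inj[OF L F0 F1] by blast
  qed
  then show ?case using IH0 IH1 by simp
qed auto

lemma set_full_tree: "set_dtree (full_tree L F) \<subseteq> set L"
proof (induction L arbitrary: F)
  case (Cons e L)
  show ?case using Cons[of "without e F"] Cons[of "link e F"] by auto
qed simp

lemma ordered_full_tree:
  "sorted_wrt (strictly_before r) L \<Longrightarrow> ordered_tree r (full_tree L F)"
proof (induction L arbitrary: F)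
  case (Cons e L)
  then show ?case using set_full_tree[of L "without e F"] set_full_tree[of L "link e F"] by auto
qed simp


section \<open>Bases of a matroid\<close>

context matroid
begin

lemma finite_indep: "X \<in> indep \<Longrightarrow> finite X"
  using finite_ground indep_subset finite_subset by blast

lemma card_le_basis:
  assumes "B \<in> bases indep" "X \<in> indep"
  shows "card X \<le> card B"
proof (rule ccontr)
  assume "\<not> card X \<le> card B"
  then obtain y where "y \<in> X - B" "insert y B \<in> indep"
    using assms indep_augment[of B X] by (auto simp: bases_def)
  then show False using assms(1) by (auto simp: bases_def)
qed

lemma basis_if_card_eq:
  assumes "B \<in> bases indep" "X \<in> indep" "card X = card B"
  shows "X \<in> bases indep"
proof -
  have "Y = X" if "Y \<in> indep" "X \<subseteq> Y" for Y
    using that card_le_basis[OF assms(1) that(1)] assms(3) finite_indep card_seteq by metis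
  then show ?thesis using assms(2) by (auto simp: bases_def)
qed

text \<open>All bases have the same size, so \<open>X - {x}\<close> can be augmented from
  \<open>Y\<close>; the outcome is independent and as large as a basis, hence a basis.\<close>

lemma exchange_bases: "exchange (bases indep)"
  unfolding exchange_def
proof (intro ballI)
  fix X Y x assume X: "X \<in> bases indep" and Y: "Y \<in> bases indep" and x: "x \<in> X - Y"
  have XI: "X \<in> indep" and YI: "Y \<in> indep" using X Y by (auto simp: bases_def)
  have "card (X - {x}) < card X" using x card_Diff1_less[OF finite_indep[OF XI]] by blast
  also have "card X = card Y" using card_le_basis X Y XI YI by (simp add: le_antisym)
  finally obtain y where y: "y \<in> Y - (X - {x})" "insert y (X - {x}) \<in> indep"
    using indep_augment[OF indep_mono[OF XI] YI, of "X - {x}"] by auto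
  \<comment> \<open>The new element differs from \<open>x\<close>, because it lies in
    \<open>Y\<close> and \<open>x\<close> does not.\<close>
  have yX: "y \<notin> X" using x y by auto
  have "card (insert y (X - {x})) = card X"
    using yX x finite_indep[OF XI] card_Suc_Diff1[of X x] by simp
  then show "\<exists>y \<in> Y - X. insert y (X - {x}) \<in> bases indep"
    using y yX basis_if_card_eq[OF X y(2)] by auto
qed

lemma bases_Pow: "bases indep \<subseteq> Pow E"
  using indep_subset by (auto simp: bases_def)

lemma down_bases: "down (bases indep) = indep"
proof
  show "down (bases indep) \<subseteq> indep"
    using indep_mono by (auto simp: down_def bases_def)
  show "indep \<subseteq> down (bases indep)"
  proof
    fix X assume X: "X \<in> indep"
    have "finite indep"
      using finite_ground indep_subset by (meson PowI finite_Pow_iff finite_subset subsetI)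
    then obtain B where "B \<in> indep" "X \<subseteq> B" "\<And>Y. Y \<in> indep \<Longrightarrow> B \<subseteq> Y \<Longrightarrow> Y = B"
      using finite_has_maximal2[OF _ X] by metis
    then show "X \<in> down (bases indep)" by (auto simp: down_def bases_def)
  qed
qed

end


section \<open>Unfolding a diagram\<close>

text \<open>A relation rather than a function, since a record of this type may contain cycles or
  arcs to missing nodes; vertices leading to these unfold to no tree.\<close>

inductive unfolds :: "('n, 'a) diagram \<Rightarrow> 'n vertex \<Rightarrow> 'a dtree \<Rightarrow> bool" for D where
  unfolds_Bot: "unfolds D Bot Leaf0"
| unfolds_Top: "unfolds D Top Leaf1"
| unfolds_Node: "n \<in> nodes D \<Longrightarrow> unfolds D (succ0 D n) s \<Longrightarrow> unfolds D (succ1 D n) t \<Longrightarrow>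
    unfolds D (Node n) (Branch (label D n) s t)"

inductive_cases unfolds_BotE: "unfolds D Bot t"
inductive_cases unfolds_TopE: "unfolds D Top t"
inductive_cases unfolds_NodeE: "unfolds D (Node n) t"
inductive_cases unfolds_Leaf0E: "unfolds D v Leaf0"
inductive_cases unfolds_Leaf1E: "unfolds D v Leaf1"
inductive_cases unfolds_BranchE: "unfolds D v (Branch e s t)"

lemma unfolds_unique: "unfolds D v t \<Longrightarrow> unfolds D v t' \<Longrightarrow> t = t'"
proof (induction arbitrary: t' rule: unfolds.induct)
  case (unfolds_Node n s t)
  then show ?case by (metis unfolds_NodeE)
qed (auto elim: unfolds_BotE unfolds_TopE)

definition unfolds_inj :: "('n, 'a) diagram \<Rightarrow> bool" where
  "unfolds_inj D \<longleftrightarrow> (\<forall>u v t. unfolds D u t \<longrightarrow> unfolds D v t \<longrightarrow> u = v)"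

definition reachable :: "('n, 'a) diagram \<Rightarrow> 'n vertex \<Rightarrow> bool" where
  "reachable D v \<longleftrightarrow> (root D, v) \<in> (arcs D)\<^sup>*"

text \<open>The invariant of all reduction steps. Order and labels are left to conditions on
  \<open>t\<close>.\<close>

definition proper :: "('n, 'a) diagram \<Rightarrow> 'a dtree \<Rightarrow> bool" where
  "proper D t \<longleftrightarrow> finite (nodes D) \<and> unfolds D (root D) t \<and> (\<forall>n \<in> nodes D. reachable D (Node n))"

lemma arc_cases:
  assumes "(u, v) \<in> arcs D"
  obtains n where "n \<in> nodes D" "u = Node n" "v = succ0 D n \<or> v = succ1 D n"
  using assms by (auto simp: arcs_def target_def split: if_splits)

lemma arc0: "n \<in> nodes D \<Longrightarrow> (Node n, succ0 D n) \<in> arcs D"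
  unfolding arcs_def target_def by (force intro: exI[of _ False])

lemma arc1: "n \<in> nodes D \<Longrightarrow> (Node n, succ1 D n) \<in> arcs D"
  unfolding arcs_def target_def by (force intro: exI[of _ True])

lemma reachable_step: "reachable D u \<Longrightarrow> (u, v) \<in> arcs D \<Longrightarrow> reachable D v"
  unfolding reachable_def by (rule rtrancl_into_rtrancl)

text \<open>Arcs into \<open>Bot\<close> are exempt: they occur only at the end of a path, and they
  are what redirection and (Z-ND) take away.\<close>

lemma reachable_map:
  assumes "reachable D v" "v \<noteq> Bot" "root D' = f (root D)"
    and "\<And>u w. (u, w) \<in> arcs D \<Longrightarrow> w \<noteq> Bot \<Longrightarrow> (f u, f w) \<in> (arcs D')\<^sup>*"
  shows "reachable D' (f v)"
  using assms(1,2) unfolding reachable_def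
proof (induction rule: rtrancl_induct)
  case base
  then show ?case using assms(3) by simp
next
  case (step u w)
  have "u \<noteq> Bot" using step(2) by (auto elim: arc_cases)
  then show ?case using step assms(4)[OF step(2)] by (meson rtrancl_trans)
qed

text \<open>Each arc of a path from the root passes to a child of the current tree. \<open>P\<close>
  stays arbitrary to serve order, labels, distinctness of children, and occurrence in another
  diagram.\<close>

lemma reachable_subtree:
  assumes "reachable D v" "unfolds D (root D) t" "P t"
    and P: "\<And>e s t. P (Branch e s t) \<Longrightarrow> P s \<and> P t"
  shows "\<exists>s. unfolds D v s \<and> P s"
  using assms(1) unfolding reachable_def
proof (induction rule: rtrancl_induct)
  case base
  then show ?case using assms by blast
next
  case (step u w)
  then obtain s where s: "unfolds D u s" "P s" by blast
  from step(2) obtain n where n: "u = Node n" "w = succ0 D n \<or> w = succ1 D n"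
    by (auto elim: arc_cases)
  from s(1) n(1) obtain a b where "s = Branch (label D n) a b"
    "unfolds D (succ0 D n) a" "unfolds D (succ1 D n) b" by (auto elim: unfolds_NodeE)
  then show ?case using n(2) s(2) P by metis
qed

lemma proper_subtree:
  assumes "proper D t" "n \<in> nodes D" "P t"
    and "\<And>e s t. P (Branch e s t) \<Longrightarrow> P s \<and> P t"
  shows "\<exists>a b. unfolds D (succ0 D n) a \<and> unfolds D (succ1 D n) b \<and>
    unfolds D (Node n) (Branch (label D n) a b) \<and> P (Branch (label D n) a b)"
proof -
  obtain s where "unfolds D (Node n) s" "P s"
    using reachable_subtree[of D "Node n" t P] assms unfolding proper_def by blast
  then show ?thesis by (metis unfolds_NodeE)
qed

lemma proper_verts:
  assumes "proper D t" "v \<in> verts D"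
  shows "reachable D v" "\<exists>s. unfolds D v s"
proof -
  show "reachable D v"
  proof (cases "v = root D \<or> v \<in> Node ` nodes D")
    case True
    then show ?thesis using assms(1) by (auto simp: proper_def reachable_def)
  next
    case False
    then obtain u where u: "(u, v) \<in> arcs D" using assms(2) by (auto simp: verts_def)
    then have "reachable D u" using assms(1) by (auto simp: proper_def elim: arc_cases)
    then show ?thesis using u by (rule reachable_step)
  qed
  then show "\<exists>s. unfolds D v s"
    using reachable_subtree[of D v t "\<lambda>_. True"] assms unfolding proper_def by blast
qed

lemma proper_nodes:
  assumes "proper D t"
  shows "{n. Node n \<in> verts D} = nodes D"
  using proper_verts(2)[OF assms] by (auto simp: verts_def elim: unfolds_NodeE)

lemma unfolds_size_arc:
  assumes "(u, v) \<in> arcs D" "unfolds D u s" "unfolds D v t"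
  shows "size t < size s"
proof -
  from assms(1) obtain n where n: "u = Node n" "v = succ0 D n \<or> v = succ1 D n"
    by (auto elim: arc_cases)
  from assms(2) n(1) obtain a b where "s = Branch (label D n) a b"
    "unfolds D (succ0 D n) a" "unfolds D (succ1 D n) b" by (auto elim: unfolds_NodeE)
  then show ?thesis using n(2) unfolds_unique[OF assms(3)] by auto
qed

text \<open>The size of the unfolding decreases along every arc.\<close>

lemma proper_acyclic:
  assumes "proper D t"
  shows "acyclic (arcs D)"
proof -
  define f where "f v = size (THE s. unfolds D v s)" for v
  have "f v < f u" if "(u, v) \<in> arcs D" for u v
  proof -
    have "u \<in> verts D" "v \<in> verts D"
      using that by (force simp: verts_def elim: arc_cases)+
    then obtain s s' where s: "unfolds D u s" "unfolds D v s'"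
      using proper_verts(2)[OF assms] by metis
    then have "f u = size s" "f v = size s'"
      unfolding f_def using unfolds_unique by (metis the_equality)+
    then show ?thesis using unfolds_size_arc[OF that s] by simp
  qed
  then have "arcs D \<subseteq> (measure f)\<inverse>" by auto
  moreover have "acyclic ((measure f)\<inverse>)" by (simp add: wf_acyclic)
  ultimately show ?thesis by (rule acyclic_subset[rotated])
qed

lemma decision_diagram_if_proper:
  assumes "proper D t" "ordered_tree r t" "set_dtree t \<subseteq> E"
  shows "decision_diagram E r D"
proof -
  have labels: "label D n \<in> E \<and>
      (\<forall>b m. target D b n = Node m \<longrightarrow> strictly_before r (label D n) (label D m))"
    if n: "n \<in> nodes D" for n
  proof -
    obtain a b where ab: "unfolds D (succ0 D n) a" "unfolds D (succ1 D n) b"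
      and P: "ordered_tree r (Branch (label D n) a b)" "set_dtree (Branch (label D n) a b) \<subseteq> E"
      using proper_subtree[OF assms(1) n, of "\<lambda>t. ordered_tree r t \<and> set_dtree t \<subseteq> E"] assms
      by auto
    have "label D m \<in> set_dtree s" if "unfolds D (Node m) s" for m s
      using that by (auto elim: unfolds_NodeE)
    then show ?thesis using P ab by (auto simp: target_def)
  qed
  have verts: "verts D \<subseteq> {Bot, Top} \<union> Node ` nodes D"
  proof
    fix v assume "v \<in> verts D"
    then obtain s where "unfolds D v s" using proper_verts(2)[OF assms(1)] by blast
    then show "v \<in> {Bot, Top} \<union> Node ` nodes D" by cases auto
  qed
  \<comment> \<open>An arc entering the root would close a cycle, because its tail is reachable from
    the root.\<close>
  have "(u, root D) \<notin> arcs D" for u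
  proof
    assume u: "(u, root D) \<in> arcs D"
    then have "u \<in> verts D" by (auto simp: verts_def elim: arc_cases)
    then have "(root D, u) \<in> (arcs D)\<^sup>*"
      using proper_verts(1)[OF assms(1)] by (simp add: reachable_def)
    with u have "(u, u) \<in> (arcs D)\<^sup>+" by (meson rtrancl_into_trancl2)
    then show False using proper_acyclic[OF assms(1)] by (simp add: acyclic_def)
  qed
  \<comment> \<open>Any other vertex is entered by the last arc of a path from the root.\<close>
  moreover have "v = root D" if "v \<in> verts D" "\<nexists>u. (u, v) \<in> arcs D" for v
    using proper_verts(1)[OF assms(1) that(1)] that(2) unfolding reachable_def by (metis rtranclE)
  moreover have "root D \<in> verts D" by (simp add: verts_def)
  ultimately have "{v \<in> verts D. \<nexists>u. (u, v) \<in> arcs D} = {root D}" by blast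
  then show ?thesis
    unfolding decision_diagram_def
    using labels verts proper_acyclic[OF assms(1)] assms(1) unfolding proper_def by blast
qed


section \<open>Represented families\<close>

inductive_cases path_BotE: "path D Bot p w"
inductive_cases path_TopE: "path D Top p w"
inductive_cases path_NodeE: "path D (Node n) p w"

text \<open>\<open>Q\<close> will be the constraint that a path puts on \<open>X\<close> for BDDs,
  and the equation for the represented set for ZDDs.\<close>

lemma ex_path_Node_iff:
  assumes "n \<in> nodes D"
  shows "(\<exists>p. path D (Node n) p Top \<and> Q p) \<longleftrightarrow>
    (\<exists>q. path D (succ0 D n) q Top \<and> Q ((n, False) # q)) \<or>
    (\<exists>q. path D (succ1 D n) q Top \<and> Q ((n, True) # q))"
proof -
  have "path D (Node n) p Top \<longleftrightarrow> (\<exists>b q. p = (n, b) # q \<and> path D (target D b n) q Top)" for p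
    using assms by (auto elim: path_NodeE intro: path_Cons)
  then show ?thesis unfolding target_def ex_bool_eq by auto
qed

lemma path_Bot_iff: "\<not> path D Bot p Top"
  by (auto elim: path_BotE)

lemma path_Top_iff: "path D Top p Top \<longleftrightarrow> p = []"
  by (auto elim: path_TopE intro: path_Nil)

lemma b_eval_iff_path:
  "unfolds D v t \<Longrightarrow>
     (\<exists>p. path D v p Top \<and> (\<forall>n. (n, True) \<in> set p \<longrightarrow> label D n \<in> X) \<and>
        (\<forall>n. (n, False) \<in> set p \<longrightarrow> label D n \<notin> X)) \<longleftrightarrow> b_eval t X"
proof (induction rule: unfolds.induct)
  case (unfolds_Node n s t)
  let ?C = "\<lambda>p. (\<forall>n. (n, True) \<in> set p \<longrightarrow> label D n \<in> X) \<and>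
      (\<forall>n. (n, False) \<in> set p \<longrightarrow> label D n \<notin> X)"
  have "?C ((n, True) # q) \<longleftrightarrow> label D n \<in> X \<and> ?C q"
    "?C ((n, False) # q) \<longleftrightarrow> label D n \<notin> X \<and> ?C q" for q by auto
  then show ?case
    using unfolds_Node.IH unfolding ex_path_Node_iff[OF unfolds_Node(1)] by auto
qed (auto simp: path_Bot_iff path_Top_iff)

lemma bdd_family_eq: "unfolds D (root D) t \<Longrightarrow> bdd_family E D = {X. X \<subseteq> E \<and> b_eval t X}"
  unfolding bdd_family_def one_path_def using b_eval_iff_path by fastforce

lemma z_sets_eq_path:
  "unfolds D v t \<Longrightarrow> {{label D n | n. (n, True) \<in> set p} | p. path D v p Top} = z_sets t"
proof (induction rule: unfolds.induct)
  case (unfolds_Node n s t)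
  let ?A = "\<lambda>p. {label D n | n. (n, True) \<in> set p}"
  have A: "?A ((n, False) # q) = ?A q" "?A ((n, True) # q) = insert (label D n) (?A q)" for q
    by auto
  have "Z \<in> {?A p | p. path D (Node n) p Top} \<longleftrightarrow>
      Z \<in> {?A q | q. path D (succ0 D n) q Top} \<union>
        insert (label D n) ` {?A q | q. path D (succ1 D n) q Top}" for Z
    using ex_path_Node_iff[OF unfolds_Node(1), of "\<lambda>p. Z = ?A p"] unfolding A by blast
  then show ?case using unfolds_Node.IH by (simp add: set_eq_iff)
qed (auto simp: path_Bot_iff path_Top_iff)

lemma zdd_family_eq: "unfolds D (root D) t \<Longrightarrow> zdd_family D = z_sets t"
  unfolding zdd_family_def one_path_def by (rule z_sets_eq_path)


section \<open>Reduction steps\<close>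

lemma remove_node_simps:
  "root (remove_node D n v) = redirect n v (root D)"
  "label (remove_node D n v) = label D"
  "succ0 (remove_node D n v) k = redirect n v (succ0 D k)"
  "succ1 (remove_node D n v) k = redirect n v (succ1 D k)"
  by (simp_all add: remove_node_def)

lemma redirect_simps:
  "redirect n v (Node n) = v" "redirect n v v = v" "k \<noteq> n \<Longrightarrow> redirect n v (Node k) = Node k"
  "redirect n v Bot = Bot" "redirect n v Top = Top"
  by (auto simp: redirect_def)

lemma unfolds_remove_node_same:
  assumes "m \<in> nodes D" "m \<noteq> n" "label D m = label D n"
    "succ0 D m = succ0 D n" "succ1 D m = succ1 D n"
  shows "unfolds D v t \<Longrightarrow> unfolds (remove_node D n (Node m)) (redirect n (Node m) v) t"
proof (induction rule: unfolds.induct)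
  case (unfolds_Node k s t)
  \<comment> \<open>\<open>?k\<close> is the node that stands for \<open>k\<close> after the
    merge.\<close>
  let ?D' = "remove_node D n (Node m)" and ?k = "if k = n then m else k"
  have "unfolds ?D' (Node ?k) (Branch (label ?D' ?k) s t)"
    using unfolds_Node assms by (intro unfolds.unfolds_Node) (auto simp: remove_node_simps)
  then show ?case using assms by (auto simp: remove_node_simps redirect_def)
qed (auto simp: redirect_simps intro: unfolds.intros)

text \<open>\<open>f\<close> is to be \<open>b_reduce\<close> or \<open>z_reduce\<close>: dropping
  the branch at \<open>n\<close> keeps its normal form, and the normal form of a branch depends only
  on those of its children, which carries the equality upward.\<close>

lemma unfolds_remove_node:
  assumes skip: "\<And>s t. unfolds D (succ0 D n) s \<Longrightarrow> unfolds D (succ1 D n) t \<Longrightarrow>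
      f (Branch (label D n) s t) = f s"
    and cong: "\<And>e s t s' t'. f s = f s' \<Longrightarrow> f t = f t' \<Longrightarrow> f (Branch e s t) = f (Branch e s' t')"
  shows "unfolds D v t \<Longrightarrow>
    \<exists>t'. unfolds (remove_node D n (succ0 D n)) (redirect n (succ0 D n) v) t' \<and> f t' = f t"
proof (induction rule: unfolds.induct)
  case (unfolds_Node k s t)
  let ?D' = "remove_node D n (succ0 D n)"
  from unfolds_Node.IH obtain s' t' where
    s': "unfolds ?D' (succ0 ?D' k) s'" "f s' = f s" and
    t': "unfolds ?D' (succ1 ?D' k) t'" "f t' = f t"
    by (auto simp: remove_node_simps)
  show ?case
  proof (cases "k = n")
    case True
    then show ?thesis using s' skip unfolds_Node by (auto simp: remove_node_simps redirect_simps)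
  next
    case False
    then have "unfolds ?D' (Node k) (Branch (label ?D' k) s' t')"
      using s' t' unfolds_Node by (intro unfolds.unfolds_Node) auto
    then show ?thesis
      using False cong[OF s'(2) t'(2)] by (auto simp: remove_node_simps redirect_simps)
  qed
qed (auto simp: redirect_simps intro: unfolds.intros)

lemma arc_remove_node:
  assumes "(u, w) \<in> arcs D" "u \<noteq> Node n"
  shows "(redirect n v u, redirect n v w) \<in> arcs (remove_node D n v)"
proof -
  from assms(1) obtain k where "k \<in> nodes D" "u = Node k" "w = succ0 D k \<or> w = succ1 D k"
    by (rule arc_cases)
  then show ?thesis
    using assms(2) arc0[of k "remove_node D n v"] arc1[of k "remove_node D n v"]
    by (auto simp: remove_node_simps redirect_simps)
qed

text \<open>A path through \<open>n\<close> is rerouted through its replacement \<open>v\<close>, so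
  the arcs leaving \<open>n\<close> are the ones that call for a substitute path.\<close>

lemma reachable_remove_node:
  assumes "\<And>w. (Node n, w) \<in> arcs D \<Longrightarrow> w \<noteq> Bot \<Longrightarrow>
      (v, redirect n v w) \<in> (arcs (remove_node D n v))\<^sup>*"
    and "\<forall>k \<in> nodes D. reachable D (Node k)" "k \<in> nodes (remove_node D n v)"
  shows "reachable (remove_node D n v) (Node k)"
proof -
  have "reachable (remove_node D n v) (redirect n v (Node k))"
  proof (rule reachable_map[where f = "redirect n v" and D = D and v = "Node k"])
    fix u w assume "(u, w) \<in> arcs D" "w \<noteq> Bot"
    then show "(redirect n v u, redirect n v w) \<in> (arcs (remove_node D n v))\<^sup>*"
      using assms(1) arc_remove_node[of u w D n v] by (cases "u = Node n") (auto simp: redirect_simps)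
  qed (use assms in \<open>auto simp: remove_node_simps\<close>)
  then show ?thesis using assms(3) by (simp add: redirect_simps)
qed

lemma ns_step_proper:
  assumes "ns_step D D'" "proper D t"
  shows "proper D' t"
proof -
  from assms(1) obtain m n where mn: "m \<in> nodes D" "m \<noteq> n" "label D m = label D n"
    "succ0 D m = succ0 D n" "succ1 D m = succ1 D n" and D': "D' = remove_node D n (Node m)"
    by (auto simp: ns_step_def)
  have "reachable D' (Node k)" if "k \<in> nodes D'" for k
    unfolding D'
  proof (rule reachable_remove_node)
    fix w assume "(Node n, w) \<in> arcs D"
    then have "w = succ0 D m \<or> w = succ1 D m" using mn by (auto elim: arc_cases)
    then have "(Node m, w) \<in> arcs D" using mn(1) arc0 arc1 by metis
    from arc_remove_node[OF this, of n "Node m"]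
    show "(Node m, redirect n (Node m) w) \<in> (arcs (remove_node D n (Node m)))\<^sup>*"
      using mn(2) by (auto simp: redirect_simps)
  qed (use assms(2) that D' in \<open>auto simp: proper_def\<close>)
  then show ?thesis
    using assms(2) unfolds_remove_node_same[OF mn] by (auto simp: proper_def D' remove_node_simps)
qed

text \<open>Common to (B-ND) and (Z-ND): in both, every arc from \<open>n\<close> to a vertex other
  than \<open>Bot\<close> leads to \<open>succ0 D n\<close>, the vertex that replaces
  \<open>n\<close>.\<close>

lemma nd_step_proper:
  assumes "proper D t" and succ1: "succ1 D n = succ0 D n \<or> succ1 D n = Bot"
    and D': "D' = remove_node D n (succ0 D n)"
    and "\<And>s t. unfolds D (succ0 D n) s \<Longrightarrow> unfolds D (succ1 D n) t \<Longrightarrow>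
      f (Branch (label D n) s t) = f s"
    and "\<And>e s t s' t'. f s = f s' \<Longrightarrow> f t = f t' \<Longrightarrow> f (Branch e s t) = f (Branch e s' t')"
  shows "\<exists>t'. proper D' t' \<and> f t' = f t"
proof -
  obtain t' where t': "unfolds D' (root D') t'" "f t' = f t"
    using unfolds_remove_node[where f = f and v = "root D" and t = t, OF assms(4,5)] assms(1)
    unfolding D' proper_def remove_node_simps by blast
  have "reachable D' (Node k)" if "k \<in> nodes D'" for k
    unfolding D'
  proof (rule reachable_remove_node)
    fix w assume "(Node n, w) \<in> arcs D" "w \<noteq> Bot"
    then have "w = succ0 D n" using succ1 by (auto elim: arc_cases)
    then show "(succ0 D n, redirect n (succ0 D n) w) \<in> (arcs (remove_node D n (succ0 D n)))\<^sup>*"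
      by (simp add: redirect_simps)
  qed (use assms(1) that D' in \<open>auto simp: proper_def\<close>)
  then show ?thesis using t' assms(1) by (auto simp: proper_def D')
qed

lemma bdd_step_proper:
  assumes "bdd_step D D'" "proper D t"
  shows "\<exists>t'. proper D' t' \<and> b_reduce t' = b_reduce t"
  using assms(1) unfolding bdd_step_def
proof
  assume "b_nd_step D D'"
  then obtain n where n: "succ0 D n = succ1 D n" "D' = remove_node D n (succ0 D n)"
    by (auto simp: b_nd_step_def)
  show ?thesis
    by (rule nd_step_proper[OF assms(2) _ n(2)]) (use n(1) unfolds_unique in fastforce)+
qed (use ns_step_proper assms(2) in blast)

lemma zdd_step_proper:
  assumes "zdd_step D D'" "proper D t"
  shows "\<exists>t'. proper D' t' \<and> z_reduce t' = z_reduce t"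
  using assms(1) unfolding zdd_step_def
proof
  assume "z_nd_step D D'"
  then obtain n where n: "succ1 D n = Bot" "D' = remove_node D n (succ0 D n)"
    by (auto simp: z_nd_step_def)
  show ?thesis
    by (rule nd_step_proper[OF assms(2) _ n(2)]) (use n(1) in \<open>auto elim: unfolds_BotE\<close>)
qed (use ns_step_proper assms(2) in blast)

lemma steps_proper:
  assumes "step\<^sup>*\<^sup>* D D'" "proper D t"
    and "\<And>D D' t. step D D' \<Longrightarrow> proper D t \<Longrightarrow> \<exists>t'. proper D' t' \<and> f t' = f t"
  shows "\<exists>t'. proper D' t' \<and> f t' = f t"
  using assms(1)
proof (induction rule: rtranclp_induct)
  case (step D1 D2)
  then show ?case using assms(3) by metis
qed (use assms(2) in blast)

text \<open>Nodes with equal trees have, by induction, equal successors, so (NS) would apply if they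
  were different.\<close>

lemma ns_irreducible_unfolds_inj:
  assumes "irreducible_for ns_step D"
  shows "unfolds_inj D"
proof -
  have "u = v" if "unfolds D u t" "unfolds D v t" for u v t
    using that
  proof (induction arbitrary: v rule: unfolds.induct)
    case (unfolds_Node n s t)
    from unfolds_Node.prems obtain m where m: "v = Node m" "m \<in> nodes D" "label D m = label D n"
      "unfolds D (succ0 D m) s" "unfolds D (succ1 D m) t" by (auto elim: unfolds_BranchE)
    then have "succ0 D n = succ0 D m" "succ1 D n = succ1 D m" using unfolds_Node.IH by auto
    then show ?case
      using assms m unfolds_Node.hyps(1) unfolding irreducible_for_def ns_step_def by metis
  qed (auto elim: unfolds_Leaf0E unfolds_Leaf1E)
  then show ?thesis unfolding unfolds_inj_def by blast
qed

lemma bdd_irreducible_normal: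
  assumes "irreducible_for bdd_step D" "unfolds D v t"
  shows "b_reduce t = t"
proof -
  have inj: "unfolds_inj D"
    using assms(1) by (intro ns_irreducible_unfolds_inj) (auto simp: irreducible_for_def bdd_step_def)
  show ?thesis
    using assms(2)
  proof (induction rule: unfolds.induct)
    case (unfolds_Node n s t)
    have "succ0 D n \<noteq> succ1 D n"
      using assms(1) unfolds_Node.hyps(1)
      by (auto simp: irreducible_for_def bdd_step_def b_nd_step_def)
    then have "s \<noteq> t" using inj unfolds_Node unfolding unfolds_inj_def by blast
    then show ?case using unfolds_Node.IH by simp
  qed auto
qed

lemma zdd_irreducible_normal:
  assumes "irreducible_for zdd_step D" "unfolds D v t"
  shows "z_reduce t = t"
  using assms(2)
proof (induction rule: unfolds.induct)
  case (unfolds_Node n s t)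
  have "succ1 D n \<noteq> Bot"
    using assms(1) unfolds_Node.hyps(1)
    by (auto simp: irreducible_for_def zdd_step_def z_nd_step_def)
  then have "t \<noteq> Leaf0" using unfolds_Node.hyps(3) by (auto elim: unfolds_Leaf0E)
  then show ?case using unfolds_Node.IH by simp
qed auto

text \<open>The steps preserve the normal form and the final tree is its own normal form, so the
  tree of the outcome does not depend on the order of the steps.\<close>

lemma exhaustively_bdd:
  assumes "exhaustively bdd_step D D'" "proper D t"
  shows "proper D' (b_reduce t)" "unfolds_inj D'"
proof -
  from assms obtain t' where t': "proper D' t'" "b_reduce t' = b_reduce t"
    using steps_proper[of bdd_step D D' t b_reduce] bdd_step_proper
    unfolding exhaustively_def by blast
  then show "proper D' (b_reduce t)"
    using assms(1) bdd_irreducible_normal unfolding exhaustively_def proper_def by metis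
  show "unfolds_inj D'"
    using assms(1) by (intro ns_irreducible_unfolds_inj)
      (auto simp: exhaustively_def irreducible_for_def bdd_step_def)
qed

lemma exhaustively_zdd:
  assumes "exhaustively zdd_step D D'" "proper D t"
  shows "proper D' (z_reduce t)" "unfolds_inj D'"
proof -
  from assms obtain t' where t': "proper D' t'" "z_reduce t' = z_reduce t"
    using steps_proper[of zdd_step D D' t z_reduce] zdd_step_proper
    unfolding exhaustively_def by blast
  then show "proper D' (z_reduce t)"
    using assms(1) zdd_irreducible_normal unfolding exhaustively_def proper_def by metis
  show "unfolds_inj D'"
    using assms(1) by (intro ns_irreducible_unfolds_inj)
      (auto simp: exhaustively_def irreducible_for_def zdd_step_def)
qed


section \<open>Isomorphism\<close>

text \<open>Unfoldings travel both ways along the bijection: \<open>pull\<close> gives the tree of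
  \<open>D\<close> and \<open>push\<close> the injectivity of its unfolding. Reachability comes back
  along the inverse.\<close>

lemma isomorphic_proper:
  assumes "isomorphic D D'" "proper D' t" "unfolds_inj D'"
  shows "proper D t" "unfolds_inj D"
proof -
  from assms(1) obtain f where bij: "bij_betw f {n. Node n \<in> verts D} {n. Node n \<in> verts D'}"
    and im: "f ` nodes D = nodes D'" and rt: "root D' = map_vertex f (root D)"
    and f: "\<And>n. n \<in> nodes D \<Longrightarrow> label D' (f n) = label D n \<and>
      succ0 D' (f n) = map_vertex f (succ0 D n) \<and> succ1 D' (f n) = map_vertex f (succ1 D n)"
    unfolding isomorphic_def by blast
  have sub: "nodes D \<subseteq> {n. Node n \<in> verts D}" by (auto simp: verts_def)
  \<comment> \<open>The bijection also covers nodes that the root or the arcs of \<open>D\<close>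
    mention without being stored; as the stored ones already map onto \<open>nodes D'\<close>, there
    are no others.\<close>
  have "n \<in> nodes D" if "Node n \<in> verts D" for n
  proof -
    have "f n \<in> f ` nodes D" using that bij im proper_nodes[OF assms(2)] by (auto simp: bij_betw_def)
    then show ?thesis using that bij sub by (auto simp: bij_betw_def dest: inj_onD)
  qed
  then have nodes: "{n. Node n \<in> verts D} = nodes D" using sub by blast
  then have inj: "inj_on f (nodes D)" using bij by (simp add: bij_betw_def)
  have succ: "succ0 D n \<in> verts D" "succ1 D n \<in> verts D" if "n \<in> nodes D" for n
    using arc0[OF that] arc1[OF that] by (force simp: verts_def)+
  have pull: "unfolds D' v' s \<Longrightarrow> v \<in> verts D \<Longrightarrow> v' = map_vertex f v \<Longrightarrow> unfolds D v s" for v v' s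
  proof (induction arbitrary: v rule: unfolds.induct)
    case (unfolds_Node n' s t)
    then obtain n where n: "v = Node n" "n' = f n" by (cases v) auto
    then have nD: "n \<in> nodes D" using unfolds_Node.prems nodes by blast
    then show ?case
      using unfolds_Node f[OF nD] n succ[OF nD] unfolds.unfolds_Node[OF nD] by auto
  next
    case unfolds_Bot
    then show ?case by (cases v) (auto intro: unfolds.intros)
  next
    case unfolds_Top
    then show ?case by (cases v) (auto intro: unfolds.intros)
  qed
  have push: "unfolds D v s \<Longrightarrow> unfolds D' (map_vertex f v) s" for v s
  proof (induction rule: unfolds.induct)
    case (unfolds_Node n s t)
    then show ?case using f[of n] im unfolds.unfolds_Node[of "f n" D' s t] by auto
  qed (auto intro: unfolds.intros)
  let ?g = "map_vertex (inv_into (nodes D) f)"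
  have g: "?g (map_vertex f v) = v" if "v \<in> verts D" for v
    using that nodes inj by (cases v) (auto intro!: inv_into_f_f)
  have "reachable D (Node n)" if n: "n \<in> nodes D" for n
  proof -
    have "reachable D (?g (Node (f n)))"
    proof (rule reachable_map[where f = ?g and D = D' and v = "Node (f n)"])
      show "reachable D' (Node (f n))" using n im assms(2) by (auto simp: proper_def)
      show "root D = ?g (root D')" using rt g[of "root D"] by (simp add: verts_def)
      fix u w assume "(u, w) \<in> arcs D'"
      then obtain k where k: "k \<in> nodes D" "u = Node (f k)"
        "w = succ0 D' (f k) \<or> w = succ1 D' (f k)" unfolding im[symmetric] by (metis arc_cases im imageE)
      then have "?g u = Node k" "?g w = succ0 D k \<or> ?g w = succ1 D k"
        using inj f[OF k(1)] g succ[OF k(1)] by auto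
      then show "(?g u, ?g w) \<in> (arcs D)\<^sup>*" using arc0[OF k(1)] arc1[OF k(1)] by auto
    qed simp
    then show ?thesis using n inj by simp
  qed
  moreover have "finite (nodes D)" using inj im assms(2) by (metis finite_imageD proper_def)
  moreover have "unfolds D (root D) t"
    using pull[of "root D'" t "root D"] rt assms(2) by (simp add: proper_def verts_def)
  ultimately show "proper D t" by (simp add: proper_def)
  have "u = v" if uv: "unfolds D u s" "unfolds D v s" for u v s
  proof -
    have "map_vertex f u = map_vertex f v"
      using push uv assms(3) unfolding unfolds_inj_def by blast
    moreover have "set_vertex u \<subseteq> nodes D" "set_vertex v \<subseteq> nodes D"
      using uv by (auto elim: unfolds.cases)
    ultimately show ?thesis
      using inj by (cases u; cases v) (auto dest: inj_onD)
  qed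
  then show "unfolds_inj D" unfolding unfolds_inj_def by blast
qed

text \<open>Occurring as the unfolding of a reachable vertex of \<open>D'\<close> is inherited by
  subtrees, and it holds of the common tree \<open>t\<close>.\<close>

lemma proper_same_tree:
  assumes "proper D t" "proper D' t" "n \<in> nodes D"
  shows "\<exists>n' \<in> nodes D'. \<exists>s. unfolds D (Node n) s \<and> unfolds D' (Node n') s"
proof -
  let ?P = "\<lambda>s. \<exists>v'. reachable D' v' \<and> unfolds D' v' s"
  have "\<exists>s. unfolds D (Node n) s \<and> ?P s"
  proof (rule reachable_subtree)
    show "reachable D (Node n)" "unfolds D (root D) t" using assms by (auto simp: proper_def)
    show "?P t" using assms(2) by (auto simp: proper_def reachable_def)
    show "?P s \<and> ?P t" if st: "?P (Branch e s t)" for e s t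
    proof -
      from st obtain n' where n': "reachable D' (Node n')" "n' \<in> nodes D'"
        "unfolds D' (succ0 D' n') s" "unfolds D' (succ1 D' n') t" by (auto elim: unfolds_BranchE)
      then show ?thesis using reachable_step arc0[OF n'(2)] arc1[OF n'(2)] by metis
    qed
  qed
  then obtain s v' where s: "unfolds D (Node n) s" "unfolds D' v' s" by blast
  then obtain e a b where "s = Branch e a b" by (auto elim: unfolds_NodeE)
  then obtain n' where "v' = Node n'" "n' \<in> nodes D'" using s(2) by (auto elim: unfolds_BranchE)
  then show ?thesis using s by blast
qed

text \<open>The isomorphism matches nodes with the same unfolding. Injective unfolding of
  \<open>D\<close> makes it injective, and that of \<open>D'\<close> makes it surjective and
  compatible with root and successors.\<close>

lemma isomorphic_if_same_tree:
  assumes "proper D t" "unfolds_inj D" "proper D' t" "unfolds_inj D'"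
  shows "isomorphic D D'"
proof -
  obtain f where f: "\<And>n. n \<in> nodes D \<Longrightarrow>
      f n \<in> nodes D' \<and> (\<exists>s. unfolds D (Node n) s \<and> unfolds D' (Node (f n)) s)"
    using proper_same_tree[OF assms(1,3)] by metis
  have map: "unfolds D' (map_vertex f v) s" if v: "unfolds D v s" for v s
  proof (cases v)
    case (Node n)
    then have "n \<in> nodes D" using v by (auto elim: unfolds_NodeE)
    then show ?thesis using f[of n] v Node unfolds_unique by fastforce
  qed (use v in \<open>auto elim: unfolds_BotE unfolds_TopE intro: unfolds.intros\<close>)
  have inj: "inj_on f (nodes D)"
  proof (rule inj_onI)
    fix m n assume mn: "m \<in> nodes D" "n \<in> nodes D" "f m = f n"
    obtain s s' where "unfolds D (Node m) s" "unfolds D' (Node (f m)) s"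
      "unfolds D (Node n) s'" "unfolds D' (Node (f n)) s'" using f mn(1,2) by blast
    then show "m = n" using mn(3) assms(2) unfolds_unique unfolding unfolds_inj_def by (metis vertex.inject)
  qed
  have im: "f ` nodes D = nodes D'"
  proof
    show "nodes D' \<subseteq> f ` nodes D"
    proof
      fix n' assume "n' \<in> nodes D'"
      then obtain n s where n: "n \<in> nodes D" "unfolds D (Node n) s" "unfolds D' (Node n') s"
        using proper_same_tree[OF assms(3,1)] by blast
      have "Node n' = Node (f n)"
        using n(3) map[OF n(2)] assms(4) unfolding unfolds_inj_def by (metis vertex.map(3))
      then show "n' \<in> f ` nodes D" using n(1) by simp
    qed
  qed (use f in blast)
  have uniq: "v' = map_vertex f v" if "unfolds D v s" "unfolds D' v' s" for v v' s
    using map[OF that(1)] that(2) assms(4) unfolding unfolds_inj_def by blast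
  have "root D' = map_vertex f (root D)"
    using uniq assms(1,3) unfolding proper_def by blast
  moreover have "label D' (f n) = label D n \<and> succ0 D' (f n) = map_vertex f (succ0 D n) \<and>
      succ1 D' (f n) = map_vertex f (succ1 D n)" if n: "n \<in> nodes D" for n
  proof -
    obtain s where s: "unfolds D (Node n) s" "unfolds D' (Node (f n)) s" using f[OF n] by blast
    then obtain a b where ab: "s = Branch (label D n) a b"
      "unfolds D (succ0 D n) a" "unfolds D (succ1 D n) b" by (auto elim: unfolds_NodeE)
    then have "label D' (f n) = label D n"
      "unfolds D' (succ0 D' (f n)) a" "unfolds D' (succ1 D' (f n)) b"
      using s(2) by (auto elim: unfolds_NodeE)
    then show ?thesis using uniq ab(2,3) by blast
  qed
  ultimately show ?thesis
    unfolding isomorphic_def proper_nodes[OF assms(1)] proper_nodes[OF assms(3)]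
    using inj im by (intro exI[of _ f]) (auto simp: bij_betw_def)
qed


section \<open>The complete binary decision tree\<close>

definition sorted_elements :: "'a set \<Rightarrow> 'a rel \<Rightarrow> 'a list" where
  "sorted_elements E r = map (nth_smallest E r) [0..<card E]"

lemma length_sorted_elements [simp]: "length (sorted_elements E r) = card E"
  by (simp add: sorted_elements_def)

lemma nth_sorted_elements: "j < card E \<Longrightarrow> sorted_elements E r ! j = nth_smallest E r j"
  by (simp add: sorted_elements_def)

text \<open>The number of smaller elements is a strictly increasing \<open>rank\<close>, mapping
  \<open>E\<close> bijectively onto \<open>{..<card E}\<close>; \<open>nth_smallest\<close> is its
  inverse.\<close>

lemma sorted_elements:
  assumes "finite E" "linear_order_on E r"
  shows "set (sorted_elements E r) = E" "distinct (sorted_elements E r)"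
    "sorted_wrt (strictly_before r) (sorted_elements E r)"
proof -
  define rank where "rank e = card {x \<in> E. strictly_before r x e}" for e
  have trans: "trans r" and antisym: "antisym r" and total: "total_on E r"
    using assms(2) by (auto simp: linear_order_on_def partial_order_on_def preorder_on_def)
  have mono: "rank x < rank y" if "x \<in> E" "strictly_before r x y" for x y
  proof -
    have "{z \<in> E. strictly_before r z x} \<subset> {z \<in> E. strictly_before r z y}"
      using that transD[OF trans] antisymD[OF antisym] unfolding strictly_before_def by blast
    then show ?thesis unfolding rank_def using assms(1) by (intro psubset_card_mono) auto
  qed
  have tri: "x = y \<or> strictly_before r x y \<or> strictly_before r y x" if "x \<in> E" "y \<in> E" for x y
    using total that unfolding total_on_def strictly_before_def by blast
  have inj: "inj_on rank E"
    using tri mono by (intro inj_onI) (metis less_irrefl)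
  have "rank e < card E" if "e \<in> E" for e
  proof -
    have "{x \<in> E. strictly_before r x e} \<subset> E" using that by (auto simp: strictly_before_def)
    then show ?thesis unfolding rank_def using assms(1) by (intro psubset_card_mono)
  qed
  then have rank: "rank ` E = {..<card E}"
    using card_image[OF inj] by (intro card_subset_eq) auto
  have nth_rank: "nth_smallest E r (rank e) = e" if "e \<in> E" for e
    unfolding nth_smallest_def rank_def[symmetric]
    using that inj by (intro the_equality) (auto dest: inj_onD)
  have nth: "nth_smallest E r j \<in> E \<and> rank (nth_smallest E r j) = j" if "j < card E" for j
  proof -
    from that rank obtain e where "e \<in> E" "rank e = j" by (metis imageE lessThan_iff)
    then show ?thesis using nth_rank by auto
  qed
  have "e \<in> nth_smallest E r ` {..<card E}" if "e \<in> E" for e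
    using nth_rank[OF that] rank that by (metis imageI)
  then show "set (sorted_elements E r) = E"
    using nth by (auto simp: sorted_elements_def atLeast0LessThan)
  then show "distinct (sorted_elements E r)" by (intro card_distinct) simp
  show "sorted_wrt (strictly_before r) (sorted_elements E r)"
    unfolding sorted_wrt_iff_nth_less
  proof (intro allI impI)
    fix i j assume ij: "i < j" "j < length (sorted_elements E r)"
    then have "i < card E" "j < card E" by auto
    note n = nth[OF this(1)] nth[OF this(2)]
    have "\<not> strictly_before r (nth_smallest E r j) (nth_smallest E r i)"
      using mono n ij(1) by (metis less_asym)
    then show "strictly_before r (sorted_elements E r ! i) (sorted_elements E r ! j)"
      using n tri ij \<open>i < card E\<close> by (metis less_irrefl length_sorted_elements nth_sorted_elements)
  qed
qed

definition chosen :: "'a list \<Rightarrow> bool list \<Rightarrow> 'a set" where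
  "chosen L p = {L ! j | j. j < length p \<and> p ! j}"

lemma chosen_snoc:
  "chosen L (p @ [b]) = (if b then insert (L ! length p) (chosen L p) else chosen L p)"
proof -
  have "j < length (p @ [b]) \<and> (p @ [b]) ! j \<longleftrightarrow>
      (j < length p \<and> p ! j) \<or> (b \<and> j = length p)" for j
    by (auto simp: nth_append less_Suc_eq)
  then show ?thesis unfolding chosen_def by auto
qed

text \<open>At position \<open>p\<close> the undecided elements form a tail of \<open>L\<close>, and
  the family left consists of the sets completing the choices made so far to a member of
  \<open>S\<close>. The induction is on the number of remaining levels.\<close>

lemma unfolds_tree_vertex:
  assumes L: "L = sorted_elements E r" "distinct L"
  shows "length p \<le> card E \<Longrightarrow>
    unfolds (decision_tree E r S) (tree_vertex E r S p)
      (full_tree (drop (length p) L) {X. X \<subseteq> set (drop (length p) L) \<and> chosen L p \<union> X \<in> S})"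
proof (induction "card E - length p" arbitrary: p)
  case 0
  then have len: "length p = card E" by simp
  have "{nth_smallest E r j | j. j < length p \<and> p ! j} = chosen L p"
    unfolding chosen_def using len L(1) nth_sorted_elements[of _ E r] by metis
  then show ?case using len L(1) by (auto simp: tree_vertex_def intro: unfolds.intros)
next
  case (Suc k)
  let ?D = "decision_tree E r S" and ?n = "length p"
  let ?F = "\<lambda>p. {X. X \<subseteq> set (drop (length p) L) \<and> chosen L p \<union> X \<in> S}"
  define e where "e = L ! ?n"
  have len: "?n < card E" using Suc.hyps(2) by simp
  have drop: "drop ?n L = e # drop (Suc ?n) L"
    unfolding e_def using len L(1) by (metis Cons_nth_drop_Suc length_sorted_elements)
  have e: "e \<notin> set (drop (Suc ?n) L)"
    using distinct_drop[OF L(2), of ?n] drop by simp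
  have IH: "unfolds ?D (tree_vertex E r S (p @ [b])) (full_tree (drop (Suc ?n) L) (?F (p @ [b])))" for b
    using Suc.hyps(1)[of "p @ [b]"] Suc.hyps(2) len by simp
  have F0: "without e (?F p) = ?F (p @ [False])"
    using e drop by (auto simp: without_def chosen_snoc)
  have F1: "link e (?F p) = ?F (p @ [True])"
    using e drop by (auto simp: link_def chosen_snoc e_def[symmetric])
  have "label ?D p = e"
    using len L(1) nth_sorted_elements[of ?n E r] by (simp add: decision_tree_def e_def)
  moreover have "unfolds ?D (Node p) (Branch (label ?D p)
      (full_tree (drop (Suc ?n) L) (?F (p @ [False]))) (full_tree (drop (Suc ?n) L) (?F (p @ [True]))))"
    using IH len by (intro unfolds.unfolds_Node) (auto simp: decision_tree_def)
  ultimately show ?case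
    unfolding drop full_tree.simps F0[unfolded drop] F1[unfolded drop]
    using len by (simp add: tree_vertex_def)
qed

lemma proper_decision_tree:
  assumes "finite E" "linear_order_on E r" "S \<subseteq> Pow E"
  shows "proper (decision_tree E r S) (full_tree (sorted_elements E r) S)"
proof -
  let ?D = "decision_tree E r S"
  have "{X. X \<subseteq> E \<and> chosen (sorted_elements E r) [] \<union> X \<in> S} = S"
    using assms(3) by (auto simp: chosen_def)
  then have "unfolds ?D (root ?D) (full_tree (sorted_elements E r) S)"
    using unfolds_tree_vertex[OF refl sorted_elements(2)[OF assms(1,2)], of "[]" S]
    by (simp add: decision_tree_def sorted_elements(1)[OF assms(1,2)])
  moreover have "length p < card E \<Longrightarrow> reachable ?D (Node p)" for p
  proof (induction p rule: rev_induct)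
    case Nil
    then show ?case by (simp add: reachable_def decision_tree_def tree_vertex_def)
  next
    case (snoc b p)
    then have "reachable ?D (Node p)" "p \<in> nodes ?D" by (simp_all add: decision_tree_def)
    moreover have "Node (p @ [b]) = (if b then succ1 ?D p else succ0 ?D p)"
      using snoc.prems by (simp add: decision_tree_def tree_vertex_def)
    ultimately show ?case using reachable_step arc0[of p ?D] arc1[of p ?D] by metis
  qed
  ultimately show ?thesis
    using finite_nodes_decision_tree[of E r S] unfolding proper_def by (simp add: decision_tree_def)
qed

text \<open>Every exhaustive reduction of the decision tree has these two properties; conversely,
  one such reduction exists, and it is isomorphic to every diagram that has them.\<close>

lemma is_BDD_iff:
  assumes "finite E" "linear_order_on E r" "S \<subseteq> Pow E"
  shows "is_BDD E r S D \<longleftrightarrow>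
    proper D (b_reduce (full_tree (sorted_elements E r) S)) \<and> unfolds_inj D"
proof -
  note tree = exhaustively_bdd[OF _ proper_decision_tree[OF assms]]
  obtain D' where "exhaustively bdd_step (decision_tree E r S) D'"
    using bdd_exhaustively_exists[OF finite_nodes_decision_tree] by blast
  then show ?thesis
    unfolding is_BDD_def using tree isomorphic_proper isomorphic_if_same_tree by metis
qed

lemma is_ZDD_iff:
  assumes "finite E" "linear_order_on E r" "S \<subseteq> Pow E"
  shows "is_ZDD E r S D \<longleftrightarrow>
    proper D (z_reduce (full_tree (sorted_elements E r) S)) \<and> unfolds_inj D"
proof -
  note tree = exhaustively_zdd[OF _ proper_decision_tree[OF assms]]
  obtain D' where "exhaustively zdd_step (decision_tree E r S) D'"
    using zdd_exhaustively_exists[OF finite_nodes_decision_tree] by blast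
  then show ?thesis
    unfolding is_ZDD_def using tree isomorphic_proper isomorphic_if_same_tree by metis
qed

lemma is_BDD_represents:
  assumes "finite E" "linear_order_on E r" "S \<subseteq> Pow E" "is_BDD E r S D"
  shows "bdd_represents E r D S"
proof -
  let ?L = "sorted_elements E r"
  note L = sorted_elements[OF assms(1,2)]
  have proper: "proper D (b_reduce (full_tree ?L S))" using is_BDD_iff assms by blast
  have "bdd_family E D = {X. X \<subseteq> E \<and> X \<inter> E \<in> S}"
    using bdd_family_eq[of D "b_reduce (full_tree ?L S)" E] proper L(1)
    by (simp add: proper_def b_eval_b_reduce b_eval_full_tree[OF L(2)])
  also have "\<dots> = S" using assms(3) by (auto simp: Int_absorb2)
  finally show ?thesis
    unfolding bdd_represents_def
    using decision_diagram_if_proper[OF proper ordered_b_reduce[OF ordered_full_tree[OF L(3)]]]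
      set_b_reduce[of "full_tree ?L S"] set_full_tree[of ?L S] L(1) by blast
qed

lemma is_ZDD_represents:
  assumes "finite E" "linear_order_on E r" "S \<subseteq> Pow E" "is_ZDD E r S D"
  shows "zdd_represents E r D S"
proof -
  let ?L = "sorted_elements E r"
  note L = sorted_elements[OF assms(1,2)]
  have proper: "proper D (z_reduce (full_tree ?L S))" using is_ZDD_iff assms by blast
  have "zdd_family D = S"
    using zdd_family_eq[of D "z_reduce (full_tree ?L S)"] proper assms(3) L(1)
    by (simp add: proper_def z_sets_z_reduce z_sets_full_tree[OF L(2)])
  then show ?thesis
    unfolding zdd_represents_def
    using decision_diagram_if_proper[OF proper ordered_z_reduce[OF ordered_full_tree[OF L(3)]]]
      set_z_reduce[of "full_tree ?L S"] set_full_tree[of ?L S] L(1) by blast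
qed


section \<open>Redirecting the 0-arcs\<close>

lemma redirect_zero_arcs_simps:
  "nodes (redirect_zero_arcs D) = nodes D" "root (redirect_zero_arcs D) = root D"
  "label (redirect_zero_arcs D) = label D" "succ1 (redirect_zero_arcs D) = succ1 D"
  "succ0 (redirect_zero_arcs D) n = (if succ0 D n = Bot then succ1 D n else succ0 D n)"
  by (simp_all add: redirect_zero_arcs_def)

lemma unfolds_redirect_zero_arcs:
  "unfolds D v t \<Longrightarrow> unfolds (redirect_zero_arcs D) v (redirect_tree t)"
proof (induction rule: unfolds.induct)
  case (unfolds_Node n s t)
  let ?D = "redirect_zero_arcs D"
  \<comment> \<open>The test on the tree agrees with the test on the arc, because only
    \<open>Bot\<close> unfolds to \<open>Leaf0\<close>.\<close>
  have "s = Leaf0 \<longleftrightarrow> succ0 D n = Bot"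
    using unfolds_Node.hyps(2) by (auto elim: unfolds_BotE unfolds_Leaf0E)
  then have "unfolds ?D (Node n) (Branch (label ?D n) (redirect_tree (if s = Leaf0 then t else s))
      (redirect_tree t))"
    using unfolds_Node by (intro unfolds.unfolds_Node) (auto simp: redirect_zero_arcs_simps)
  then show ?case by (simp add: redirect_zero_arcs_simps)
qed (auto intro: unfolds.intros)

lemma proper_redirect_zero_arcs:
  assumes "proper D t"
  shows "proper (redirect_zero_arcs D) (redirect_tree t)"
proof -
  let ?D = "redirect_zero_arcs D"
  have "reachable ?D (Node n)" if n: "n \<in> nodes D" for n
  proof (rule reachable_map[where f = "\<lambda>v. v" and D = D and v = "Node n"])
    fix u w assume "(u, w) \<in> arcs D" and w: "w \<noteq> Bot"
    then obtain k where "k \<in> nodes D" "u = Node k" "w = succ0 D k \<or> w = succ1 D k"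
      by (auto elim: arc_cases)
    then show "(u, w) \<in> (arcs ?D)\<^sup>*"
      using w arc0[of k ?D] arc1[of k ?D] by (auto simp: redirect_zero_arcs_simps)
  qed (use n assms in \<open>auto simp: proper_def redirect_zero_arcs_simps\<close>)
  then show ?thesis
    using assms unfolds_redirect_zero_arcs by (auto simp: proper_def redirect_zero_arcs_simps)
qed

text \<open>If just one of two nodes to be merged had its 0-arc redirected, the 0-successor of the
  other would be their common 1-successor, hence its own. Distinct children exclude this, so the
  nodes already agreed before the redirection.\<close>

lemma ns_irreducible_redirect_zero_arcs:
  assumes "proper D t" "unfolds_inj D" "hereditarily (\<noteq>) t"
  shows "irreducible_for ns_step (redirect_zero_arcs D)"
proof -
  have tree: "\<exists>a b. unfolds D (succ0 D n) a \<and> unfolds D (succ1 D n) b \<and>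
      unfolds D (Node n) (Branch (label D n) a b) \<and> a \<noteq> b" if "n \<in> nodes D" for n
    using proper_subtree[OF assms(1) that, of "hereditarily (\<noteq>)"] assms(3) by auto
  have succ: "succ0 D n \<noteq> succ1 D n" if "n \<in> nodes D" for n
    using tree[OF that] unfolds_unique by metis
  have "m = n" if m: "m \<in> nodes D" and n: "n \<in> nodes D" and l: "label D m = label D n"
    and s1: "succ1 D m = succ1 D n"
    and s0: "succ0 (redirect_zero_arcs D) m = succ0 (redirect_zero_arcs D) n" for m n
  proof -
    have "succ0 D m = succ0 D n"
      using s0 s1 succ[OF m] succ[OF n] by (auto simp: redirect_zero_arcs_simps split: if_splits)
    then have "\<exists>s. unfolds D (Node m) s \<and> unfolds D (Node n) s"
      using tree[OF m] tree[OF n] l s1 unfolds_unique by metis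
    then show ?thesis using assms(2) unfolding unfolds_inj_def by blast
  qed
  then show ?thesis
    unfolding irreducible_for_def ns_step_def by (auto simp: redirect_zero_arcs_simps)
qed

theorem theorem3p5:
  fixes E :: "'a set" and indep :: "'a set set" and r :: "'a rel"
  assumes "matroid E indep"
    and "linear_order_on E r"
  shows "(\<forall>B D :: ('n, 'a) diagram.
            is_BDD E r (bases indep) B \<longrightarrow>
            exhaustively bdd_step (redirect_zero_arcs B) D \<longrightarrow>
              bdd_represents E r D indep \<and> is_BDD E r indep D) \<and>
         (\<forall>Z :: ('m, 'a) diagram.
            is_ZDD E r (bases indep) Z \<longrightarrow>
              zdd_represents E r (redirect_zero_arcs Z) indep \<and>
              irreducible_for zdd_step (redirect_zero_arcs Z) \<and>
              is_ZDD E r indep (redirect_zero_arcs Z))"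
proof -
  interpret matroid E indep by (rule assms(1))
  let ?L = "sorted_elements E r"
  note E = finite_ground assms(2)
  note L = sorted_elements[OF E]
  have bases: "bases indep \<subseteq> Pow (set ?L)" and indep: "indep \<subseteq> Pow E"
    using bases_Pow indep_subset L(1) by auto
  show ?thesis
  proof (intro conjI[of "All _"] allI impI)
    fix B D :: "('n, 'a) diagram"
    assume B: "is_BDD E r (bases indep) B" and D: "exhaustively bdd_step (redirect_zero_arcs B) D"
    have "proper B (b_reduce (full_tree ?L (bases indep)))"
      using B is_BDD_iff[OF E bases_Pow] by blast
    note exhaustively_bdd[OF D proper_redirect_zero_arcs[OF this]]
    \<comment> \<open>The tree of \<open>D\<close> is the normal form of the redirected tree of the
      bases, which is that of their down-closure, the independent sets.\<close>
    then have "is_BDD E r indep D"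
      using b_reduce_redirect_tree[OF L(2) bases exchange_bases]
      by (simp add: is_BDD_iff[OF E indep] down_bases)
    then show "bdd_represents E r D indep \<and> is_BDD E r indep D"
      using is_BDD_represents[OF E indep] by blast
  next
    fix Z :: "('m, 'a) diagram"
    assume "is_ZDD E r (bases indep) Z"
    then have Z: "proper Z (z_reduce (full_tree ?L (bases indep)))" "unfolds_inj Z"
      using is_ZDD_iff[OF E bases_Pow] by blast+
    have ns: "irreducible_for ns_step (redirect_zero_arcs Z)"
      using Z z_reduce_full_tree_exchange[OF L(2) bases exchange_bases]
      by (rule ns_irreducible_redirect_zero_arcs)
    \<comment> \<open>Redirection leaves the 1-arcs alone, so (Z-ND) remains inapplicable as it is
      in \<open>Z\<close>.\<close>
    have "succ1 Z n \<noteq> Bot" if n: "n \<in> nodes Z" for n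
    proof -
      obtain b where "unfolds Z (succ1 Z n) b" "b \<noteq> Leaf0"
        using proper_subtree[OF Z(1) n, of "hereditarily (\<lambda>s t. t \<noteq> Leaf0)", OF z_reduce_normal]
        by auto
      then show ?thesis by (auto elim: unfolds_BotE)
    qed
    then have "irreducible_for zdd_step (redirect_zero_arcs Z)"
      using ns unfolding irreducible_for_def zdd_step_def z_nd_step_def
      by (auto simp: redirect_zero_arcs_simps)
    moreover have "is_ZDD E r indep (redirect_zero_arcs Z)"
      using proper_redirect_zero_arcs[OF Z(1)] ns_irreducible_unfolds_inj[OF ns]
        redirect_tree_z_reduce[OF L(2) bases exchange_bases]
      by (simp add: is_ZDD_iff[OF E indep] down_bases)
    ultimately show "zdd_represents E r (redirect_zero_arcs Z) indep \<and>
        irreducible_for zdd_step (redirect_zero_arcs Z) \<and> is_ZDD E r indep (redirect_zero_arcs Z)"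
      using is_ZDD_represents[OF E indep] by blast
  qed
qed

end
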